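(* Let $G\in\mathcal M$ be analytic at $0$ with $G(0)=0$ and $0<|G'(0)|<1$ (a stable fixed point at zero). Then the difference equation $x_{n+1}=G(x_n)$ has the Painlevé property if and only if there are $a,b\in\mathbb C$ with $|a|<1$ such that $$G(z)=\frac{az}{1+bz}.$$
   Context: $\mathcal M$ (the "mostly analytic functions") is the class of functions analytic in the complement (in $\mathbb C$) of a closed countable set, which may depend on the function. Conjugation map and continuation of solutions. For $G$ analytic at $0$ with $G(0)=0$, $G'(0)=a$, $0<|a|<1$, let $\varphi$ be the unique map analytic at $0$ with $\varphi(0)=0$, $\varphi'(0)=1$ and $\varphi(az)=G(\varphi(z))$ near $0$ (it exists by Poincaré's theorem). The solutions of $x_{n+1}=G(x_n)$ tending to $0$ are, for large $n$, $x_n=\varphi(Ca^n)$ with $C\in\mathbb C$, and they are continued to complex $z$ by $x(z)=x(z;C)=\varphi(Ca^z)$ (initially for those $z$ with $Ca^z$ near $0$, where $a^z=e^{z\ln a}$ for a fixed choice of $\ln a$). Painlevé property. The equation has the Painlevé property if the analytic continuations of its solutions $x(z;C)$ have only isolated singularities (apart from singularities whose location is common to all solutions); for this class of equations this amounts to: $\varphi$ extends to a single-valued analytic function on $\mathbb C$ except for isolated singularities. A singular point $z_0$ of $f$ is isolated if $f$ is (single-valued and) analytic in some disk centered at $z_0$ except perhaps at $z_0$ itself; branch points and points of singularity barriers are not isolated singularities. *)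

theory Defs
  imports "HOL-Complex_Analysis.Complex_Analysis"
begin

text \<open>A mostly analytic function is represented by a total function whose values outside its
  domain of analyticity are arbitrary.\<close>

definition mostly_analytic :: "(complex \<Rightarrow> complex) \<Rightarrow> bool" where
  "mostly_analytic G \<longleftrightarrow> (\<exists>E. closed E \<and> countable E \<and> G analytic_on (- E))"

text \<open>The Poincare conjugation map of the fixed point 0. Only its germ at 0 is determined by
  these conditions; the values of \<open>\<phi>\<close> away from 0 carry no information.\<close>

definition conjugation_map :: "(complex \<Rightarrow> complex) \<Rightarrow> (complex \<Rightarrow> complex) \<Rightarrow> bool" where
  "conjugation_map G \<phi> \<longleftrightarrow>
     \<phi> analytic_on {0} \<and> \<phi> 0 = 0 \<and> deriv \<phi> 0 = 1 \<and>
     (\<forall>\<^sub>F z in nhds 0. \<phi> (deriv G 0 * z) = G (\<phi> z))"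

text \<open>The solution \<open>x(z; C) = \<phi> (C a\<^sup>z)\<close>, where \<open>a\<^sup>z = exp (z l)\<close> for the chosen logarithm \<open>l\<close>
  of \<open>a\<close>. As it stands, the formula is meaningful only where \<open>C a\<^sup>z\<close> is near 0, which for
  \<open>C \<noteq> 0\<close> and \<open>norm a < 1\<close> is a half-plane.\<close>

definition solution :: "(complex \<Rightarrow> complex) \<Rightarrow> complex \<Rightarrow> complex \<Rightarrow> complex \<Rightarrow> complex" where
  "solution \<phi> l C z = \<phi> (C * exp (z * l))"

definition continues_solution ::
    "(complex \<Rightarrow> complex) \<Rightarrow> complex \<Rightarrow> complex \<Rightarrow> (complex \<Rightarrow> complex) \<Rightarrow> bool" where
  "continues_solution \<phi> l C f \<longleftrightarrow>
     (\<exists>r>0. \<forall>z. norm (C * exp (z * l)) < r \<longrightarrow> f z = solution \<phi> l C z)"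

text \<open>Every solution continues to a single-valued function on the plane having only isolated
  singularities: around each point, \<open>f\<close> is analytic in some punctured disk (so the singular set
  is closed and discrete). Singularities whose location is common to all solutions need no
  exemption, since the solution with \<open>C = 0\<close> vanishes identically and has no singularity; also,
  the solutions with \<open>C \<noteq> 0\<close> are translates of each other.\<close>

definition painleve_property :: "complex \<Rightarrow> (complex \<Rightarrow> complex) \<Rightarrow> bool" where
  "painleve_property l G \<longleftrightarrow>
     (\<exists>\<phi>. conjugation_map G \<phi> \<and>
        (\<forall>C. \<exists>f. continues_solution \<phi> l C f \<and> (\<forall>z. isolated_singularity_at f z)))"

end

theory Submission
  imports Defs
begin

text \<open>
  Suppose a solution \<open>f z = \<phi> (exp (l z))\<close> continues with isolated singularities only. Its singular
  set is countable, and so is the preimage of the singular set of \<open>G\<close>; hence \<open>f (z + 1) = G (f z)\<close>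
  persists off a countable set. Iterating it pushes every point into the region where \<open>\<phi>\<close> is
  injective, so \<open>f\<close> determines \<open>exp (l z)\<close>: the values near 0, already taken where
  \<open>exp (l z)\<close> is small, are not taken elsewhere. Consequently \<open>1 / f z - exp (- l z)\<close> is bounded off
  the singularities, all of which are therefore removable, and Liouville's theorem makes it constant.
  So \<open>\<phi> w = w / (1 - c w)\<close>, and \<open>G\<close> is the claimed linear fractional map.
\<close>

section \<open>General facts: isolated singularities, countable preimages, reciprocals\<close>

lemma open_analytic_points: "open {z. f analytic_on {z}}"
proof (rule openI)
  fix z assume "z \<in> {z. f analytic_on {z}}"
  then obtain e where "0 < e" "f holomorphic_on ball z e"
    by (auto simp: analytic_at_ball)
  then show "\<exists>e>0. ball z e \<subseteq> {z. f analytic_on {z}}"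
    by (auto intro: holomorphic_on_imp_analytic_at)
qed

lemma sparse_singular_points:
  assumes "\<And>z. isolated_singularity_at f z"
  shows "{z. \<not> f analytic_on {z}} sparse_in UNIV"
  using assms unfolding sparse_in_open[OF open_UNIV] islimpt_iff_eventually
  by (simp add: isolated_singularity_at_altdef)

text \<open>Riemann's theorem removes every singularity, so \<open>remove_sings h\<close> is entire
  and bounded, and Liouville's theorem applies. The bound is asked only at points of analyticity
  because the values of \<open>h\<close> elsewhere are arbitrary.\<close>

lemma bounded_isolated_singularities_constant:
  assumes iso: "\<And>z. isolated_singularity_at h z"
    and bdd: "\<And>z. h analytic_on {z} \<Longrightarrow> norm (h z) \<le> B"
  obtains c where "\<And>z. h analytic_on {z} \<Longrightarrow> h z = c"
proof -
  define g where "g = remove_sings h"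
  have lim: "\<exists>c. (h \<longlongrightarrow> c) (at z) \<and> norm c \<le> B" for z
  proof -
    obtain r where r: "r > 0" "h analytic_on ball z r - {z}"
      using iso unfolding isolated_singularity_at_def by blast
    have hol: "h holomorphic_on ball z r - {z}"
      using r(2) analytic_imp_holomorphic by blast
    have ev: "\<forall>\<^sub>F w in at z. norm (h w) \<le> B"
      using iso[of z] unfolding isolated_singularity_at_altdef
      by (rule eventually_mono) (rule bdd)
    then obtain k where k: "k holomorphic_on ball z r" "\<forall>w\<in>ball z r - {z}. k w = h w"
      using holomorphic_on_extend_bounded[OF hol] r(1) by auto
    have "(k \<longlongrightarrow> k z) (at z)"
      using holomorphic_on_imp_analytic_at[OF k(1)] r(1)
      by (intro isContD analytic_at_imp_isCont) auto
    then have "(h \<longlongrightarrow> k z) (at z)"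
      by (rule Lim_transform_within_open[where s = "ball z r"]) (use r k in auto)
    moreover from this ev have "norm (k z) \<le> B"
      by (rule Lim_norm_ubound[OF at_neq_bot])
    ultimately show ?thesis by blast
  qed
  have "g analytic_on {z}" for z
    unfolding g_def using lim iso remove_sings_analytic_at by blast
  then have "g holomorphic_on UNIV"
    by (metis analytic_imp_holomorphic analytic_on_analytic_at)
  moreover have "bounded (range g)"
    unfolding bounded_iff g_def using lim remove_sings_eqI by (metis rangeE)
  ultimately obtain c where "\<And>z. g z = c"
    using Liouville_theorem constant_on_def by (metis UNIV_I)
  then show ?thesis
    using that unfolding g_def by (metis remove_sings_at_analytic)
qed

text \<open>Each fibre is the zero set of a nonconstant holomorphic function on a connected,
  sigma-compact open set, hence countable; the preimage is a countable union of fibres.\<close>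

lemma countable_holomorphic_preimage:
  assumes "f holomorphic_on U" "open U" "connected U" "\<not> f constant_on U" "countable E"
  shows "countable {z\<in>U. f z \<in> E}"
proof -
  have "countable {z\<in>U. f z = e}" for e
  proof -
    have "\<not> (\<lambda>z. f z - e) constant_on U"
      using assms(4) unfolding constant_on_def by (metis diff_add_cancel)
    moreover have "fsigma U"
      using open_Union_compact_subsets[OF assms(2)] unfolding fsigma_Union_compact
      by (metis (no_types, lifting) image_subset_iff mem_Collect_eq)
    ultimately show ?thesis
      using holomorphic_countable_zeros[of "\<lambda>z. f z - e" U] assms
      by (simp add: holomorphic_on_diff)
  qed
  moreover have "{z\<in>U. f z \<in> E} = (\<Union>e\<in>E. {z\<in>U. f z = e})" by auto
  ultimately show ?thesis using assms(5) by auto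
qed

lemma uncountable_open_nonempty:
  fixes S :: "'a::euclidean_space set"
  assumes "open S" "x \<in> S"
  shows "uncountable S"
proof -
  obtain e where "0 < e" "ball x e \<subseteq> S"
    using openE[OF assms] by blast
  then show ?thesis
    using countable_subset uncountable_ball by blast
qed

text \<open>Write \<open>\<phi> w = w * g w\<close> with \<open>g 0 = 1\<close>. Injectivity keeps
  \<open>g\<close> free of zeros, so the difference \<open>(1 / g w - 1) / w\<close> extends
  holomorphically over 0 and is bounded on the compact disk of radius \<open>e\<close>.\<close>

lemma reciprocal_minus_pole_bounded:
  assumes hol: "\<phi> holomorphic_on ball 0 r" and inj: "inj_on \<phi> (ball 0 r)"
    and "\<phi> 0 = 0" "deriv \<phi> 0 = 1" "e < r"
  obtains B where "\<And>w. w \<noteq> 0 \<Longrightarrow> norm w \<le> e \<Longrightarrow> norm (1 / \<phi> w - 1 / w) \<le> B"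
proof (cases "e < 0")
  case True
  then show ?thesis using that norm_ge_zero by (metis leD order_trans)
next
  case False
  with \<open>e < r\<close> have r: "0 < r" by simp
  define g where "g w = (if w = 0 then 1 else \<phi> w / w)" for w
  have g_hol: "g holomorphic_on ball 0 r"
    using pole_lemma[OF hol, of 0] assms(3,4) r unfolding g_def by (simp cong: if_cong)
  have g_nz: "g w \<noteq> 0" if "w \<in> ball 0 r" for w
  proof (cases "w = 0")
    case False
    then have "\<phi> w \<noteq> \<phi> 0"
      using inj that r by (metis centre_in_ball inj_onD)
    with False show ?thesis using assms(3) by (simp add: g_def)
  qed (simp add: g_def)
  \<comment> \<open>The difference quotient of \<open>1 / g\<close> at 0, completed by the
    derivative. As \<open>g 0 = 1\<close>, it equals \<open>1 / \<phi> w - 1 / w\<close> away from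
    0.\<close>
  define k where "k w = (if w = 0 then deriv (\<lambda>w. 1 / g w) 0 else (1 / g w - 1 / g 0) / (w - 0))" for w
  have "k holomorphic_on ball 0 r"
    unfolding k_def
    by (rule pole_lemma) (use g_hol g_nz r in \<open>auto intro!: holomorphic_intros\<close>)
  then have "continuous_on (cball 0 e) k"
    by (intro holomorphic_on_imp_continuous_on, elim holomorphic_on_subset) (use \<open>e < r\<close> in auto)
  then have "compact (k ` cball 0 e)"
    by (intro compact_continuous_image) auto
  then obtain B where B: "\<And>w. w \<in> cball 0 e \<Longrightarrow> norm (k w) \<le> B"
    using compact_imp_bounded by (metis bounded_iff imageI)
  have "norm (1 / \<phi> w - 1 / w) \<le> B" if "w \<noteq> 0" "norm w \<le> e" for w
  proof -
    have "w \<in> ball 0 r" using that assms by auto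
    then have "\<phi> w \<noteq> 0" using g_nz[of w] that by (auto simp: g_def)
    then have "1 / \<phi> w - 1 / w = k w"
      using that by (simp add: k_def g_def field_simps)
    then show ?thesis using B that by simp
  qed
  then show ?thesis by (rule that)
qed

section \<open>The solution with \<open>C = 1\<close>, continued to the plane\<close>

locale continued_solution =
  fixes G \<phi> f :: "complex \<Rightarrow> complex" and a l :: complex and E :: "complex set" and r :: real
  assumes E: "closed E" "countable E" "G analytic_on - E"
    and a: "a = exp l" "norm a < 1"
    and r: "0 < r"
    and phi_hol: "\<phi> holomorphic_on ball 0 r"
    and phi_inj: "inj_on \<phi> (ball 0 r)"
    and phi_0: "\<phi> 0 = 0" "deriv \<phi> 0 = 1"
    and phi_conj: "\<And>w. w \<in> ball 0 r \<Longrightarrow> \<phi> (a * w) = G (\<phi> w)"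
    and f_phi: "\<And>z. norm (exp (z * l)) < r \<Longrightarrow> f z = \<phi> (exp (z * l))"
    and f_iso: "\<And>z. isolated_singularity_at f z"
begin

definition regular_points :: "complex set" where
  "regular_points = {z. f analytic_on {z}}"

text \<open>The condition reads \<open>Re (z * l) < ln r\<close>. This is the region where
  \<open>f\<close> is known to be given by \<open>\<phi>\<close>.\<close>

definition half_plane :: "complex set" where
  "half_plane = {z. norm (exp (z * l)) < r}"

lemma l_nonzero: "l \<noteq> 0"
  using a by auto

lemma exp_shift: "exp ((z + of_nat n) * l) = a ^ n * exp (z * l)"
  by (simp add: a exp_add distrib_right flip: exp_of_nat_mult)

lemma exp_surj: "w \<noteq> 0 \<Longrightarrow> \<exists>z. exp (z * l) = w"
  using l_nonzero by (intro exI[of _ "Ln w / l"]) simp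

lemma mult_ball: "w \<in> ball 0 s \<Longrightarrow> a ^ n * w \<in> ball 0 s"
proof -
  assume "w \<in> ball 0 s"
  moreover have "norm a ^ n * norm w \<le> 1 * norm w"
    using a by (intro mult_right_mono) (auto simp: power_le_one)
  ultimately show ?thesis by (simp add: norm_mult norm_power)
qed

lemma open_half_plane: "open half_plane"
  unfolding half_plane_def by (intro open_Collect_less continuous_intros)

lemma half_plane_regular: "half_plane \<subseteq> regular_points"
proof -
  have "(\<phi> \<circ> (\<lambda>z. exp (z * l))) holomorphic_on half_plane"
    by (rule holomorphic_on_compose_gen[OF _ phi_hol])
       (auto simp: half_plane_def intro!: holomorphic_intros)
  then have "f holomorphic_on half_plane"
    by (rule holomorphic_transform) (simp add: half_plane_def f_phi del: norm_exp_eq_Re)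
  then show ?thesis
    using open_half_plane holomorphic_on_imp_analytic_at unfolding regular_points_def by blast
qed

lemma open_regular: "open regular_points"
  unfolding regular_points_def by (rule open_analytic_points)

lemma countable_singular: "countable (- regular_points)"
  using sparse_imp_countable[OF open_UNIV sparse_singular_points[OF f_iso]]
  by (simp add: regular_points_def Collect_neg_eq)

lemma connected_regular: "connected regular_points"
  using path_connected_complement_countable[OF _ countable_singular]
  by (simp add: path_connected_imp_connected)

lemma f_hol: "f holomorphic_on regular_points"
  using analytic_on_analytic_at[of f regular_points]
  by (simp add: regular_points_def analytic_imp_holomorphic)

text \<open>Since \<open>exp (z * l)\<close> takes every nonzero value, a constant \<open>f\<close>
  would make the injective \<open>\<phi>\<close> constant on a punctured disk.\<close>

lemma f_not_constant: "\<not> f constant_on regular_points"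
proof
  assume "f constant_on regular_points"
  then obtain c where c: "\<And>z. z \<in> regular_points \<Longrightarrow> f z = c"
    by (auto simp: constant_on_def)
  have "\<phi> w = c" if "w \<in> ball 0 r" "w \<noteq> 0" for w
  proof -
    obtain z where "exp (z * l) = w" using exp_surj[OF \<open>w \<noteq> 0\<close>] by blast
    with that show ?thesis
      using c[of z] f_phi[of z] half_plane_regular by (auto simp: half_plane_def)
  qed
  then have "\<phi> (of_real (r / 2)) = \<phi> (of_real (r / 3))"
    using r by simp
  then have "complex_of_real (r / 2) = of_real (r / 3)"
    by (rule inj_onD[OF phi_inj]) (use r in auto)
  then show False
    using r by (metis of_real_eq_iff divide_cancel_left less_irrefl num.simps numeral_eq_iff)
qed

section \<open>The functional equation and its orbits\<close>

text \<open>Both sides are holomorphic on \<open>V\<close>, and they agree on its part in the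
  half-plane by the conjugation equation. The complement of \<open>V\<close> is countable, so
  \<open>V\<close> is connected and the identity theorem carries the equation over all of
  \<open>V\<close>.\<close>

lemma functional_equation_continues:
  obtains N where "countable N" "\<And>z. z \<notin> N \<Longrightarrow> f (z + 1) = G (f z)"
proof -
  define V where "V = regular_points \<inter> (\<lambda>z. z + 1) -` regular_points \<inter> (regular_points \<inter> f -` (- E))"
  have f_cont: "continuous_on regular_points f"
    using f_hol holomorphic_on_imp_continuous_on by blast
  have open_V: "open V"
    unfolding V_def
    by (intro open_Int open_regular open_vimage continuous_on_open_vimage[THEN iffD1, rule_format]
        continuous_open_preimage f_cont continuous_intros)
       (use E(1) in \<open>simp add: open_Compl\<close>)
  have "- V \<subseteq> - regular_points \<union> (\<lambda>z. z - 1) ` (- regular_points) \<union> {z\<in>regular_points. f z \<in> E}"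
    unfolding V_def by (auto intro!: image_eqI[of _ _ "_ + 1"])
  moreover have "countable {z\<in>regular_points. f z \<in> E}"
    by (intro countable_holomorphic_preimage f_hol open_regular connected_regular f_not_constant E)
  ultimately have countable_V: "countable (- V)"
    using countable_singular by (meson countable_Un countable_image countable_subset)
  have connected_V: "connected V"
    using path_connected_complement_countable[OF _ countable_V]
    by (simp add: path_connected_imp_connected)
  have "f (z + 1) = G (f z)" if "z \<in> V" for z
  proof (rule analytic_continuation_open[of "half_plane \<inter> V" V "\<lambda>z. f (z + 1)" "\<lambda>z. G (f z)"])
    obtain z0 where "exp (z0 * l) = of_real (r / 2)"
      using exp_surj[of "of_real (r / 2)"] r by auto
    then have "z0 \<in> half_plane"
      using r unfolding half_plane_def by (simp del: norm_exp_eq_Re of_real_divide)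
    \<comment> \<open>A nonempty open set cannot lie inside the countable complement of
      \<open>V\<close>, so the identity theorem has an open set to start from.\<close>
    then have "uncountable half_plane"
      by (rule uncountable_open_nonempty[OF open_half_plane])
    then have "\<not> half_plane \<subseteq> - V"
      using countable_V countable_subset by blast
    then show "half_plane \<inter> V \<noteq> {}" by auto
    have "(f \<circ> (\<lambda>z. z + 1)) holomorphic_on V"
      by (rule holomorphic_on_compose_gen[OF _ f_hol])
         (auto simp: V_def intro!: holomorphic_intros)
    then show "(\<lambda>z. f (z + 1)) holomorphic_on V"
      by (simp add: o_def)
    have "(G \<circ> f) holomorphic_on V"
      using analytic_imp_holomorphic[OF E(3)]
      by (rule holomorphic_on_compose_gen[rotated])
         (auto simp: V_def intro!: holomorphic_on_subset[OF f_hol])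
    then show "(\<lambda>z. G (f z)) holomorphic_on V"
      by (simp add: o_def)
    show "f (z + 1) = G (f z)" if "z \<in> half_plane \<inter> V" for z
    proof -
      have w: "exp (z * l) \<in> ball 0 r"
        using that by (simp add: half_plane_def)
      have *: "exp ((z + 1) * l) = a * exp (z * l)"
        using exp_shift[of z 1] by simp
      then have "f (z + 1) = \<phi> (a * exp (z * l))"
        using f_phi[of "z + 1"] mult_ball[OF w, of 1] by simp
      also have "\<dots> = G (f z)"
        using phi_conj[OF w] f_phi[of z] w by simp
      finally show ?thesis .
    qed
  qed (use open_V open_half_plane connected_V that in auto)
  then show ?thesis
    using that[OF countable_V] by auto
qed

text \<open>Discarding all backward integer translates of the exceptional set still discards only
  countably many points, and the equation then holds along the whole forward orbit of every
  remaining point.\<close>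

lemma generic_orbits:
  obtains N where "countable N"
    "\<And>z n. z \<notin> N \<Longrightarrow> f (z + of_nat (Suc n)) = G (f (z + of_nat n))"
proof -
  obtain N where N: "countable N" "\<And>z. z \<notin> N \<Longrightarrow> f (z + 1) = G (f z)"
    by (rule functional_equation_continues) blast
  define M where "M = (\<Union>n::nat. (\<lambda>z. z - of_nat n) ` N)"
  have "f (z + of_nat (Suc n)) = G (f (z + of_nat n))" if "z \<notin> M" for z n
  proof -
    have "z + of_nat n \<notin> N"
      using that unfolding M_def by (auto simp: image_iff) (metis add_diff_cancel_right')
    from N(2)[OF this] show ?thesis by (simp add: algebra_simps)
  qed
  moreover have "countable M"
    unfolding M_def using N(1) by simp
  ultimately show ?thesis using that by blast
qed

text \<open>After \<open>n\<close> steps the orbit is at \<open>\<phi> (a ^ n * w)\<close>, and for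
  large \<open>n\<close> also at \<open>\<phi> (a ^ n * exp (z * l))\<close>. Injectivity of
  \<open>\<phi>\<close> near 0 equates the arguments, and the nonzero factor \<open>a ^ n\<close>
  cancels.\<close>

lemma orbit_determines_exp:
  assumes orbit: "\<And>n. f (z + of_nat (Suc n)) = G (f (z + of_nat n))"
    and w: "w \<in> ball 0 r" "f z = \<phi> w"
  shows "exp (z * l) = w"
proof -
  have iter: "f (z + of_nat n) = \<phi> (a ^ n * w)" for n
  proof (induction n)
    case (Suc n)
    have "f (z + of_nat (Suc n)) = G (\<phi> (a ^ n * w))"
      using orbit Suc by metis
    also have "\<dots> = \<phi> (a * (a ^ n * w))"
      using phi_conj mult_ball w(1) by metis
    finally show ?case by (simp add: mult.assoc)
  qed (simp add: w)
  \<comment> \<open>Initially \<open>exp (z * l)\<close> may lie far outside the disk where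
    \<open>\<phi>\<close> is controlled; contraction by \<open>a\<close> brings it inside.\<close>
  have "(\<lambda>n. a ^ n * exp (z * l)) \<longlonglongrightarrow> 0 * exp (z * l)"
    using a by (intro tendsto_mult LIMSEQ_power_zero tendsto_const)
  from tendstoD[OF this r] obtain n where n: "norm (a ^ n * exp (z * l)) < r"
    unfolding mult_zero_left norm_conv_dist[symmetric] eventually_sequentially by blast
  then have "f (z + of_nat n) = \<phi> (a ^ n * exp (z * l))"
    using f_phi[of "z + of_nat n"] by (simp add: exp_shift)
  then have "\<phi> (a ^ n * exp (z * l)) = \<phi> (a ^ n * w)"
    using iter[of n] by simp
  then have "a ^ n * exp (z * l) = a ^ n * w"
    by (rule inj_onD[OF phi_inj]) (use n mult_ball[OF w(1)] in simp_all)
  then show ?thesis using a by simp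
qed

section \<open>Boundedness and the shape of the conjugation map\<close>

text \<open>By the open mapping theorem, all sufficiently small values are already values of
  \<open>\<phi>\<close> on \<open>ball 0 e\<close>; at a point with a generic orbit,
  \<open>orbit_determines_exp\<close> then places \<open>exp (z * l)\<close> in that ball.\<close>

lemma small_value_imp_small_exp:
  assumes "0 < e" "e < r"
  obtains d where "0 < d"
    "\<And>z. z \<in> regular_points \<Longrightarrow> norm (f z) < d \<Longrightarrow> norm (exp (z * l)) \<le> e"
proof -
  have ball: "ball 0 e \<subseteq> ball (0::complex) r"
    using assms by auto
  have "open (\<phi> ` ball 0 e)"
    by (rule open_mapping_thm3) (use ball phi_hol phi_inj in \<open>auto intro: holomorphic_on_subset inj_on_subset\<close>)
  moreover have "0 \<in> \<phi> ` ball 0 e"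
    using phi_0(1) assms by (metis centre_in_ball imageI)
  ultimately obtain d where d: "0 < d" "ball 0 d \<subseteq> \<phi> ` ball 0 e"
    using openE by blast
  have "norm (exp (z * l)) \<le> e" if z: "z \<in> regular_points" "norm (f z) < d" for z
  proof (rule ccontr)
    assume "\<not> norm (exp (z * l)) \<le> e"
    \<comment> \<open>The given point may be exceptional, but a counterexample persists on an open
      set, which is uncountable and so contains a point with a generic orbit.\<close>
    define W where "W = (regular_points \<inter> f -` ball 0 d) \<inter> {y. e < norm (exp (y * l))}"
    have "open W"
      unfolding W_def using f_hol
      by (intro open_Int continuous_open_preimage open_regular open_Collect_less continuous_intros
          holomorphic_on_imp_continuous_on open_ball)
    moreover have "z \<in> W"
      using z \<open>\<not> norm (exp (z * l)) \<le> e\<close> by (simp add: W_def)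
    ultimately have "uncountable W"
      by (rule uncountable_open_nonempty)
    obtain N where N: "countable N"
      "\<And>z n. z \<notin> N \<Longrightarrow> f (z + of_nat (Suc n)) = G (f (z + of_nat n))"
      by (rule generic_orbits) blast
    obtain y where y: "y \<in> W" "y \<notin> N"
      using \<open>uncountable W\<close> N(1) by (meson countable_subset subsetI)
    obtain w where w: "w \<in> ball 0 e" "f y = \<phi> w"
      using y(1) d(2) unfolding W_def by auto
    have "exp (y * l) = w"
      by (rule orbit_determines_exp[OF N(2)[OF y(2)] _ w(2)]) (use w ball in auto)
    then show False
      using y(1) w(1) unfolding W_def by auto
  qed
  then show ?thesis
    using that d(1) by blast
qed

text \<open>The function \<open>h\<close> is bounded at regular points: where
  \<open>exp (z * l)\<close> is small the two poles cancel, and elsewhere each reciprocal is bounded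
  separately. Hence \<open>h\<close> is constant.\<close>

lemma conjugation_linear_fractional:
  obtains c where "\<And>w. w \<noteq> 0 \<Longrightarrow> norm w < r \<Longrightarrow> 1 / \<phi> w = 1 / w + c"
proof -
  define e where "e = r / 2"
  have e: "0 < e" "e < r" using r by (auto simp: e_def)
  obtain d where d: "0 < d"
    "\<And>z. z \<in> regular_points \<Longrightarrow> norm (f z) < d \<Longrightarrow> norm (exp (z * l)) \<le> e"
    using small_value_imp_small_exp[OF e] by blast
  obtain B where B: "\<And>w. w \<noteq> 0 \<Longrightarrow> norm w \<le> e \<Longrightarrow> norm (1 / \<phi> w - 1 / w) \<le> B"
    using reciprocal_minus_pole_bounded[OF phi_hol phi_inj phi_0 e(2)] by blast
  define h where "h z = 1 / f z - 1 / exp (z * l)" for z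
  have phi_nz: "\<phi> w \<noteq> 0" if "w \<noteq> 0" "norm w < r" for w
    using inj_onD[OF phi_inj, of w 0] that phi_0(1) r by auto
  \<comment> \<open>A zero of \<open>f\<close> would force \<open>exp (z * l)\<close> into the disk
    where \<open>\<phi>\<close> vanishes only at 0, a value that \<open>exp\<close> omits.\<close>
  have f_nz: "f z \<noteq> 0" if "z \<in> regular_points" for z
  proof
    assume "f z = 0"
    then have "norm (exp (z * l)) < r"
      using d(2)[OF that] d(1) e by simp
    then show False
      using f_phi[of z] phi_nz[of "exp (z * l)"] \<open>f z = 0\<close> by simp
  qed
  have h_regular: "h analytic_on {z}" if "z \<in> regular_points" for z
    using that f_nz[OF that] unfolding h_def regular_points_def
    by (auto intro!: analytic_intros)
  have h_bound: "norm (h z) \<le> max B (1 / d + 1 / e)" if "z \<in> regular_points" for z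
  proof (cases "norm (exp (z * l)) \<le> e")
    case True
    then show ?thesis
      using B[of "exp (z * l)"] f_phi[of z] e by (simp add: h_def)
  next
    case False
    then have "d \<le> norm (f z)"
      using d(2)[OF that] by force
    then have "norm (1 / f z) \<le> 1 / d"
      using d(1) by (simp add: norm_divide frac_le)
    moreover have "norm (1 / exp (z * l)) \<le> 1 / e"
      using False e unfolding norm_divide norm_one by (intro frac_le) auto
    ultimately have "norm (h z) \<le> 1 / d + 1 / e"
      unfolding h_def using norm_triangle_ineq4 add_mono order_trans by blast
    then show ?thesis by simp
  qed
  have h_iso: "isolated_singularity_at h z" for z
    using f_iso[of z] h_regular unfolding isolated_singularity_at_altdef regular_points_def
    by (auto elim!: eventually_mono)
  \<comment> \<open>A priori \<open>h\<close> might be analytic at a singular point of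
    \<open>f\<close>; there the bound passes to the limit from the surrounding regular
    points.\<close>
  have bound: "norm (h z) \<le> max B (1 / d + 1 / e)" if "h analytic_on {z}" for z
  proof -
    have "(h \<longlongrightarrow> h z) (at z)"
      using that by (simp add: analytic_at_imp_isCont isContD)
    moreover have "\<forall>\<^sub>F w in at z. norm (h w) \<le> max B (1 / d + 1 / e)"
      using f_iso[of z] unfolding isolated_singularity_at_altdef
      by (rule eventually_mono) (rule h_bound, simp add: regular_points_def)
    ultimately show ?thesis
      by (rule Lim_norm_ubound[OF at_neq_bot])
  qed
  obtain c where c: "\<And>z. h analytic_on {z} \<Longrightarrow> h z = c"
    using bounded_isolated_singularities_constant[OF h_iso bound] by blast
  have "1 / \<phi> w = 1 / w + c" if "w \<noteq> 0" "norm w < r" for w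
  proof -
    obtain z where z: "exp (z * l) = w" using exp_surj[OF \<open>w \<noteq> 0\<close>] by blast
    then have "z \<in> regular_points"
      using half_plane_regular that by (auto simp: half_plane_def)
    then have "h z = c" using c h_regular by blast
    then show ?thesis
      using z f_phi[of z] that by (simp add: h_def algebra_simps)
  qed
  then show ?thesis by (rule that)
qed

end

section \<open>From the conjugation map to the formula for \<open>G\<close>\<close>

text \<open>Comparing \<open>1 / \<phi> w = 1 / w + c\<close> at \<open>w\<close> and at
  \<open>a * w\<close> eliminates \<open>w\<close>. The division-free form also covers
  \<open>v = 0\<close> and suits the later analytic continuation.\<close>

lemma painleve_imp_linear_fractional_near_0:
  assumes "mostly_analytic G" "G 0 = 0"
    and "0 < norm (deriv G 0)" "norm (deriv G 0) < 1" "exp l = deriv G 0"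
    and "painleve_property l G"
  obtains b where "\<forall>\<^sub>F v in nhds 0. G v * (1 + b * v) = deriv G 0 * v"
proof -
  define a where "a = deriv G 0"
  obtain \<phi> where conj: "conjugation_map G \<phi>"
    and cont: "\<And>C. \<exists>f. continues_solution \<phi> l C f \<and> (\<forall>z. isolated_singularity_at f z)"
    using assms(6) unfolding painleve_property_def by blast
  obtain E where E: "closed E" "countable E" "G analytic_on - E"
    using assms(1) unfolding mostly_analytic_def by blast
  obtain f s where f: "\<And>z. isolated_singularity_at f z" "s > 0"
    "\<And>z. norm (exp (z * l)) < s \<Longrightarrow> f z = \<phi> (exp (z * l))"
    using cont[of 1] unfolding continues_solution_def solution_def by auto
  obtain r1 where r1: "r1 > 0" "\<phi> holomorphic_on ball 0 r1"
    using conj unfolding conjugation_map_def analytic_at_ball by blast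
  have phi_0: "\<phi> 0 = 0" "deriv \<phi> 0 = 1"
    using conj unfolding conjugation_map_def by auto
  have "0 \<in> ball (0::complex) r1" "deriv \<phi> 0 \<noteq> 0"
    using r1(1) phi_0(2) by auto
  then obtain r2 where r2: "r2 > 0" "ball (0::complex) r2 \<subseteq> ball 0 r1" "inj_on \<phi> (ball 0 r2)"
    using has_complex_derivative_locally_injective[OF r1(2) _ open_ball] by blast
  have "\<forall>\<^sub>F z in nhds 0. \<phi> (a * z) = G (\<phi> z)"
    using conj unfolding conjugation_map_def a_def by blast
  then obtain r3 where r3: "r3 > 0" "\<And>z. dist z 0 < r3 \<Longrightarrow> \<phi> (a * z) = G (\<phi> z)"
    unfolding eventually_nhds_metric by blast
  \<comment> \<open>One radius for the agreement of \<open>f\<close> with \<open>\<phi>\<close>, the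
    injectivity of \<open>\<phi>\<close> and the conjugation equation.\<close>
  define r where "r = Min {s, r2, r3}"
  have r: "0 < r" "r \<le> s" "r \<le> r2" "r \<le> r3"
    using f(2) r2(1) r3(1) by (auto simp: r_def)
  interpret continued_solution G \<phi> f a l E r
  proof
    show "\<phi> holomorphic_on ball 0 r"
      using r1(2) r2(2) r(3) by (meson holomorphic_on_subset order_trans subset_ball)
    show "inj_on \<phi> (ball 0 r)"
      using r2(3) r(3) by (meson inj_on_subset subset_ball)
  qed (use E assms r f phi_0 r3 in \<open>auto simp: a_def\<close>)
  obtain c where c: "\<And>w. w \<noteq> 0 \<Longrightarrow> norm w < r \<Longrightarrow> 1 / \<phi> w = 1 / w + c"
    using conjugation_linear_fractional by blast
  have a_nz: "a \<noteq> 0" using assms(3) by (auto simp: a_def)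
  have phi_nz: "\<phi> w \<noteq> 0" if "w \<noteq> 0" "norm w < r" for w
    using inj_onD[OF phi_inj, of w 0] that phi_0(1) r(1) by auto
  \<comment> \<open>With \<open>v = \<phi> w\<close>, the two relations are
    \<open>1 / v = 1 / w + c\<close> and \<open>a / G v = 1 / w + a * c\<close>; their difference
    gives the coefficient \<open>c * (a - 1)\<close>.\<close>
  have "G v * (1 + c * (a - 1) * v) = a * v" if "v \<in> \<phi> ` ball 0 r" for v
  proof -
    obtain w where w: "w \<in> ball 0 r" "v = \<phi> w" using \<open>v \<in> \<phi> ` ball 0 r\<close> by blast
    show ?thesis
    proof (cases "w = 0")
      case True
      then show ?thesis using w phi_0 assms(2) by simp
    next
      case False
      have aw: "a * w \<noteq> 0" "norm (a * w) < r"
        using False a_nz mult_ball[OF w(1), of 1] by auto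
      have "1 / v = 1 / w + c"
        using c[OF False] w by simp
      moreover have "a * (1 / G v) = 1 / w + a * c"
        using c[OF aw] phi_conj[OF w(1)] w(2) a_nz by (simp add: distrib_left)
      ultimately have "a * (1 / G v) = 1 / v + c * (a - 1)"
        by (simp add: algebra_simps)
      moreover have "v \<noteq> 0" "G v \<noteq> 0"
        using phi_nz[OF False] phi_nz[OF aw] phi_conj[OF w(1)] w by auto
      ultimately show ?thesis by (simp add: field_simps)
    qed
  qed
  moreover have "open (\<phi> ` ball 0 r)"
    by (rule open_mapping_thm3[OF phi_hol open_ball phi_inj])
  moreover have "0 \<in> \<phi> ` ball 0 r"
    using phi_0(1) r(1) by (metis centre_in_ball imageI)
  ultimately have "\<forall>\<^sub>F v in nhds 0. G v * (1 + c * (a - 1) * v) = a * v"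
    unfolding eventually_nhds by blast
  then show ?thesis
    using that unfolding a_def by blast
qed

text \<open>The points of analyticity form a connected open set, having countable complement, so the
  identity theorem extends the relation from near 0. Without division, no pole has to be
  excised.\<close>

lemma linear_fractional_continues:
  assumes "mostly_analytic G" "G analytic_on {0}" "a \<noteq> 0"
    and near_0: "\<forall>\<^sub>F v in nhds 0. G v * (1 + b * v) = a * v"
    and z: "G analytic_on {z}"
  shows "G z = a * z / (1 + b * z)"
proof -
  define A where "A = {z. G analytic_on {z}}"
  obtain E where E: "countable E" "G analytic_on - E"
    using assms(1) unfolding mostly_analytic_def by blast
  have "open A" unfolding A_def by (rule open_analytic_points)
  have "- A \<subseteq> E"
    using E(2) analytic_on_analytic_at unfolding A_def by blast
  then have "countable (- A)" using E(1) countable_subset by blast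
  then have "connected A"
    using path_connected_complement_countable[of "- A"] by (simp add: path_connected_imp_connected)
  obtain U where U: "open U" "0 \<in> U" "\<And>v. v \<in> U \<Longrightarrow> G v * (1 + b * v) = a * v"
    using near_0 unfolding eventually_nhds by blast
  have G_hol: "G holomorphic_on A"
    unfolding A_def by (metis analytic_imp_holomorphic analytic_on_analytic_at mem_Collect_eq)
  have eq: "G z * (1 + b * z) = a * z"
    by (rule analytic_continuation_open[of "U \<inter> A" A])
       (use U \<open>open A\<close> \<open>connected A\<close> assms(2) z G_hol in
         \<open>auto simp: A_def intro!: holomorphic_intros\<close>)
  \<comment> \<open>If the factor vanished, the relation would give \<open>a * z = 0\<close>, so
    \<open>z = 0\<close>, where the factor is 1.\<close>
  have "1 + b * z \<noteq> 0"
    using eq \<open>a \<noteq> 0\<close> by auto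
  with eq show ?thesis by (simp add: eq_divide_eq)
qed

section \<open>The converse and the equivalence\<close>

text \<open>The conjugation map is an explicit linear fractional map, so each solution is given
  globally by a rational function of \<open>exp (z * l)\<close>, singular at most at the zeros of an
  entire function.\<close>

lemma linear_fractional_imp_painleve:
  assumes G: "G analytic_on {0}" "\<And>z. G analytic_on {z} \<Longrightarrow> G z = a * z / (1 + b * z)"
    and "norm (deriv G 0) < 1"
  shows "painleve_property l G"
proof -
  have near_0: "\<forall>\<^sub>F z in nhds 0. G z = a * z / (1 + b * z)"
    using open_analytic_points[of G] G by (auto simp: eventually_nhds)
  have "((\<lambda>z. a * z / (1 + b * z)) has_field_derivative a) (at 0)"
    by (auto intro!: derivative_eq_intros)
  then have "(G has_field_derivative a) (at 0)"
    using near_0 DERIV_cong_ev[OF refl near_0 refl] by blast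
  then have deriv_G: "deriv G 0 = a" by (rule DERIV_imp_deriv)
  with assms(3) have a1: "1 - a \<noteq> 0" by auto
  \<comment> \<open>For nonzero \<open>b\<close>, the second fixed point of the linear fractional
    map is \<open>(a - 1) / b = - 1 / c\<close>, and \<open>\<phi>\<close> sends infinity
    there.\<close>
  define c where "c = b / (1 - a)"
  define \<phi> where "\<phi> z = z / (1 - c * z)" for z
  have phi_analytic: "\<phi> analytic_on {z}" if "1 - c * z \<noteq> 0" for z
    unfolding \<phi>_def using that by (auto intro!: analytic_intros)
  have "(\<phi> has_field_derivative 1) (at 0)"
    unfolding \<phi>_def by (auto intro!: derivative_eq_intros)
  then have deriv_phi: "deriv \<phi> 0 = 1" by (rule DERIV_imp_deriv)
  have phi_cont: "(\<phi> \<longlongrightarrow> 0) (nhds 0)"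
    unfolding \<phi>_def by (auto intro!: tendsto_eq_intros filterlim_ident)
  have "\<forall>\<^sub>F z in nhds 0. G (\<phi> z) = a * \<phi> z / (1 + b * \<phi> z)"
    using near_0 phi_cont by (rule eventually_compose_filterlim)
  moreover have "\<forall>\<^sub>F z in nhds 0. 1 - c * z \<noteq> 0"
    by (rule tendsto_imp_eventually_ne[of _ 1]) (auto intro!: tendsto_eq_intros filterlim_ident)
  ultimately have "\<forall>\<^sub>F z in nhds 0. \<phi> (a * z) = G (\<phi> z)"
  proof eventually_elim
    case (elim z)
    have b: "b = c * (1 - a)" using a1 by (simp add: c_def)
    have "1 + b * \<phi> z = (1 - c * (a * z)) / (1 - c * z)"
      using elim(2) unfolding \<phi>_def b by (simp add: field_simps)
    then have "a * \<phi> z / (1 + b * \<phi> z) = \<phi> (a * z)"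
      using elim(2) unfolding \<phi>_def by simp
    with elim(1) show ?case by simp
  qed
  then have "conjugation_map G \<phi>"
    unfolding conjugation_map_def using deriv_G deriv_phi phi_analytic[of 0] by (simp add: \<phi>_def)
  moreover have "isolated_singularity_at (solution \<phi> l C) z" for C z
  proof -
    define k where "k z = 1 - c * (C * exp (z * l))" for z
    have sol: "solution \<phi> l C analytic_on {z}" if "k z \<noteq> 0" for z
      using that unfolding solution_def \<phi>_def k_def by (auto intro!: analytic_intros)
    have k_hol: "k holomorphic_on UNIV"
      unfolding k_def by (intro holomorphic_intros)
    show ?thesis
    proof (cases "\<forall>z. k z = 0")
      \<comment> \<open>This can occur for \<open>l = 0\<close>, as \<open>l\<close> is arbitrary
        here; division by zero then makes the solution identically 0.\<close>
      case True
      then have "solution \<phi> l C = (\<lambda>_. 0)"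
        by (auto simp: solution_def \<phi>_def k_def)
      then show ?thesis
        by (simp add: isolated_singularity_at_analytic)
    next
      case False
      then obtain y where "k y \<noteq> 0" by blast
      then have "\<forall>\<^sub>F w in at z. k w \<noteq> 0"
        using non_zero_neighbour_alt[OF k_hol open_UNIV connected_UNIV] by auto
      then show ?thesis
        unfolding isolated_singularity_at_altdef by (rule eventually_mono) (rule sol)
    qed
  qed
  moreover have "continues_solution \<phi> l C (solution \<phi> l C)" for C
    unfolding continues_solution_def by (intro exI[of _ 1]) simp
  ultimately show ?thesis
    unfolding painleve_property_def by blast
qed

text \<open>Values of \<open>G\<close> off its domain of analyticity are arbitrary, so the formula
  is claimed only at points of analyticity. The forward direction supplies
  \<open>a = deriv G 0\<close>.\<close>

theorem theorem1p5:
  fixes G :: "complex \<Rightarrow> complex" and l :: complex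
  assumes "mostly_analytic G"
    and "G analytic_on {0}" and "G 0 = 0"
    and "0 < norm (deriv G 0)" and "norm (deriv G 0) < 1"
    and "exp l = deriv G 0"
  shows "painleve_property l G \<longleftrightarrow>
    (\<exists>a b. norm a < 1 \<and> (\<forall>z. G analytic_on {z} \<longrightarrow> G z = a * z / (1 + b * z)))"
proof
  assume "painleve_property l G"
  then obtain b where "\<forall>\<^sub>F v in nhds 0. G v * (1 + b * v) = deriv G 0 * v"
    using painleve_imp_linear_fractional_near_0 assms by blast
  then have "\<forall>z. G analytic_on {z} \<longrightarrow> G z = deriv G 0 * z / (1 + b * z)"
    using linear_fractional_continues[OF assms(1,2)] assms(4) by simp
  then show "\<exists>a b. norm a < 1 \<and> (\<forall>z. G analytic_on {z} \<longrightarrow> G z = a * z / (1 + b * z))"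
    using assms(5) by blast
next
  assume "\<exists>a b. norm a < 1 \<and> (\<forall>z. G analytic_on {z} \<longrightarrow> G z = a * z / (1 + b * z))"
  then show "painleve_property l G"
    using linear_fractional_imp_painleve assms by blast
qed

end
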